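(* Let $s<\frac12$ and, for functions $u_1,u_2$ that are $2\pi$-periodic in $x$, put $$F(u_1,u_2)=\tfrac12\partial_x(u_1u_2)+\partial_x(1-\partial_x^2)^{-1}\Big[u_1u_2+\tfrac12(\partial_xu_1)(\partial_xu_2)\Big].$$ Then the bilinear estimate $$\Big\|\mathscr F^{-1}\big[\langle\tau-k^3\rangle^{-1}\mathscr F F(u_1,u_2)\big]\Big\|_{W^s}\le C\,\|u_1\|_{W^s}\|u_2\|_{W^s}$$ is invalid; that is, there is no constant $C>0$ for which it holds for all $u_1,u_2\in W^s$ that are $2\pi$-periodic in $x$.
   Context: Functions $u(x,t)$ are $2\pi$-periodic in $x$, $t\in\mathbf R$, with zero mean in $x$, so spatial frequencies range over $\dot Z=\mathbf Z\setminus\{0\}$. $\mathscr F u(k,\tau)=\int_{\mathbf R}\int_0^{2\pi}e^{-ikx}e^{-it\tau}u(x,t)\,dx\,dt$ is the space-time Fourier transform, $k\in\dot Z$, $\tau\in\mathbf R$. $\langle a\rangle=(1+|a|^2)^{1/2}$. The norms are $$\|u\|_{X_{s,b}}=\big\|\langle k\rangle^s\langle\tau-k^3\rangle^b\mathscr Fu(k,\tau)\big\|_{L^2_kL^2_\tau},\qquad \|u\|_{Y^s}=\big\|\langle k\rangle^s\mathscr Fu(k,\tau)\big\|_{L^2_kL^1_\tau},$$ where $L^2_k$ is taken with respect to counting measure on $\dot Z$, and $$\|u\|_{W^s}=\|u\|_{X_{s,1/2}}+\|u\|_{Y^s}.$$ $W^s$ is the space of functions with finite $W^s$ norm. The operator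 $\partial_x(1-\partial_x^2)^{-1}$ is the Fourier multiplier $ik/(1+k^2)$, and products correspond to convolutions on the Fourier side. *)

theory Defs
  imports "HOL-Probability.Probability"
begin

definition japanese :: "real \<Rightarrow> real" ("\<langle>_\<rangle>")
  where "\<langle>a\<rangle> = sqrt (1 + \<bar>a\<bar>\<^sup>2)"

text \<open>The frequency set, i.e. the nonzero integers.\<close>

definition Zdot :: "int set"
  where "Zdot = UNIV - {0}"


section \<open>The space-time Fourier transform\<close>

text \<open>For \<^term>\<open>u\<close> integrable over one period in \<open>x\<close> and all \<open>t\<close>, the transform is the following
  integral.\<close>

definition fourier_integral :: "(real \<Rightarrow> real \<Rightarrow> complex) \<Rightarrow> int \<Rightarrow> real \<Rightarrow> complex"
  where "fourier_integral u k \<tau> =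
    (LINT (x, t) : {0..2 * pi} \<times> UNIV | lborel \<Otimes>\<^sub>M lborel.
       exp (- \<i> * of_int k * of_real x) * exp (- \<i> * of_real t * of_real \<tau>) * u x t)"

text \<open>Functions with finite \<open>X\<^bsub>s,1/2\<^esub>\<close> norm need not be integrable in \<open>t\<close>, so in general the integral
  is understood in the usual sense of tempered distributions in \<open>t\<close>, by duality with Schwartz
  functions.\<close>

definition time_deriv :: "nat \<Rightarrow> (real \<Rightarrow> complex) \<Rightarrow> real \<Rightarrow> complex"
  where "time_deriv n = ((\<lambda>g t. vector_derivative g (at t)) ^^ n)"

definition schwartz :: "(real \<Rightarrow> complex) \<Rightarrow> bool"
  where "schwartz \<psi> \<longleftrightarrow>
    (\<forall>n t. time_deriv n \<psi> differentiable (at t)) \<and>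
    (\<forall>m n. bounded (range (\<lambda>t. of_real t ^ m * time_deriv n \<psi> t)))"

definition fourier_time :: "(real \<Rightarrow> complex) \<Rightarrow> real \<Rightarrow> complex"
  where "fourier_time \<psi> t = (LINT \<tau>|lborel. exp (- \<i> * of_real t * of_real \<tau>) * \<psi> \<tau>)"

definition tempered_in_time :: "(real \<Rightarrow> real \<Rightarrow> complex) \<Rightarrow> bool"
  where "tempered_in_time u \<longleftrightarrow>
    (\<forall>\<theta>. schwartz \<theta> \<longrightarrow>
       set_integrable (lborel \<Otimes>\<^sub>M lborel) ({0..2 * pi} \<times> UNIV) (\<lambda>(x, t). u x t * \<theta> t))"

definition is_fourier_transform ::
    "(real \<Rightarrow> real \<Rightarrow> complex) \<Rightarrow> (int \<Rightarrow> real \<Rightarrow> complex) \<Rightarrow> bool"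
  where "is_fourier_transform u f \<longleftrightarrow>
    (\<forall>k. f k \<in> borel_measurable lborel) \<and>
    (\<forall>k\<in>Zdot. \<forall>\<psi>. schwartz \<psi> \<longrightarrow>
       integrable lborel (\<lambda>\<tau>. f k \<tau> * \<psi> \<tau>) \<and>
       (LINT \<tau>|lborel. f k \<tau> * \<psi> \<tau>) =
       (LINT (x, t) : {0..2 * pi} \<times> UNIV | lborel \<Otimes>\<^sub>M lborel.
          exp (- \<i> * of_int k * of_real x) * fourier_time \<psi> t * u x t))"

text \<open>The transform is determined only up to null sets in \<open>\<tau>\<close>; everything below is
  insensitive to the choice.\<close>

definition fourier :: "(real \<Rightarrow> real \<Rightarrow> complex) \<Rightarrow> int \<Rightarrow> real \<Rightarrow> complex" ("\<F>")
  where "\<F> u = (SOME f. is_fourier_transform u f)"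


text \<open>For integrable functions the transform is indeed the integral.\<close>

lemma schwartz_continuous:
  assumes "schwartz \<psi>"
  shows "continuous_on UNIV \<psi>"
proof -
  have "time_deriv 0 \<psi> differentiable (at t)" for t
    using assms unfolding schwartz_def by blast
  then have "isCont \<psi> t" for t
    by (simp add: time_deriv_def differentiable_imp_continuous_within)
  then show ?thesis
    by (simp add: continuous_at_imp_continuous_on)
qed

lemma schwartz_integrable:
  assumes "schwartz \<psi>"
  shows "integrable lborel \<psi>"
proof -
  have "bounded (range (\<lambda>t. of_real t ^ m * time_deriv 0 \<psi> t))" for m
    using assms unfolding schwartz_def by blast
  then have bdd: "bounded (range (\<lambda>t. of_real t ^ m * \<psi> t))" for m
    by (simp add: time_deriv_def)
  obtain A B where A: "\<And>t. cmod (\<psi> t) \<le> A" and B: "\<And>t. t\<^sup>2 * cmod (\<psi> t) \<le> B"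
    using bdd[of 0] bdd[of 2] by (auto simp: bounded_iff norm_mult norm_power)
  have int: "integrable lborel (\<lambda>t. (A + B) * inverse (1 + t\<^sup>2))"
    using integrable_inverse_1_plus_square
    by (intro integrable_mult_right) (simp add: set_integrable_def einterval_eq_UNIV)
  show ?thesis
  proof (rule Bochner_Integration.integrable_bound[OF int])
    show "\<psi> \<in> borel_measurable lborel"
      using schwartz_continuous[OF assms] borel_measurable_continuous_onI by auto
    have "cmod (\<psi> t) \<le> (A + B) * inverse (1 + t\<^sup>2)" for t
    proof -
      have "(1 + t\<^sup>2) * cmod (\<psi> t) \<le> A + B"
        using A[of t] B[of t] by (simp add: algebra_simps)
      moreover have "0 < 1 + t\<^sup>2"
        by (simp add: add_pos_nonneg)
      ultimately show ?thesis
        by (simp add: field_simps)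
    qed
    then show "AE t in lborel. cmod (\<psi> t) \<le> norm ((A + B) * inverse (1 + t\<^sup>2))"
      by (intro AE_I2) (smt (verit) real_norm_def)
  qed
qed

lemma is_fourier_transform_fourier_integral:
  assumes "set_integrable (lborel \<Otimes>\<^sub>M lborel) ({0..2 * pi} \<times> UNIV) (\<lambda>(x, t). u x t)"
  shows "is_fourier_transform u (fourier_integral u)"
proof -
  define P :: "(real \<times> real) measure" where "P = lborel \<Otimes>\<^sub>M lborel"
  define U where "U z = indicat_real ({0..2 * pi} \<times> UNIV) z *\<^sub>R u (fst z) (snd z)" for z :: "real \<times> real"
  have intU: "integrable P U"
    using assms unfolding set_integrable_def P_def U_def by (simp add: case_prod_beta)
  have measU [measurable]: "U \<in> borel_measurable P"
    using intU by auto
  have sfP: "sigma_finite_measure P"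
    unfolding P_def lborel_prod by (rule sigma_finite_lborel)
  interpret pair_sigma_finite lborel P
    by (intro pair_sigma_finite.intro sigma_finite_lborel sfP)
  define G where "G k \<tau> z = exp (- \<i> * of_int k * of_real (fst z)) *
      exp (- \<i> * of_real (snd z) * of_real \<tau>) * U z" for k \<tau> z
  have [measurable]: "fst \<in> P \<rightarrow>\<^sub>M borel" "snd \<in> P \<rightarrow>\<^sub>M borel"
    unfolding P_def by simp_all
  have Gm [measurable]: "(\<lambda>(\<tau>, z). G k \<tau> z) \<in> borel_measurable (lborel \<Otimes>\<^sub>M P)" for k
    unfolding G_def by measurable
  have fi: "fourier_integral u k \<tau> = (LINT z|P. G k \<tau> z)" for k \<tau>
    unfolding fourier_integral_def set_lebesgue_integral_def G_def U_def P_def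
    by (intro Bochner_Integration.integral_cong) (auto simp: case_prod_beta)
  have normG: "cmod (G k \<tau> z) = cmod (U z)" for k \<tau> z
    unfolding G_def by (simp add: norm_mult)
  have "integrable lborel (\<lambda>\<tau>. fourier_integral u k \<tau> * \<psi> \<tau>) \<and>
       (LINT \<tau>|lborel. fourier_integral u k \<tau> * \<psi> \<tau>) =
       (LINT (x, t) : {0..2 * pi} \<times> UNIV | lborel \<Otimes>\<^sub>M lborel.
          exp (- \<i> * of_int k * of_real x) * fourier_time \<psi> t * u x t)"
    if "schwartz \<psi>" for k \<psi>
  proof -
    note int\<psi> = schwartz_integrable[OF that]
    have [measurable]: "\<psi> \<in> borel_measurable borel"
      using int\<psi> by auto
    have intG: "integrable P (G k \<tau>)" for \<tau>
    proof (rule Bochner_Integration.integrable_bound[OF intU])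
      show "G k \<tau> \<in> borel_measurable P"
        unfolding G_def by measurable
      show "AE z in P. cmod (G k \<tau> z) \<le> cmod (U z)"
        by (rule AE_I2) (simp only: normG)
    qed
    have int: "integrable (lborel \<Otimes>\<^sub>M P) (\<lambda>(\<tau>, z). G k \<tau> z * \<psi> \<tau>)"
    proof (rule Fubini_integrable)
      show "(\<lambda>(\<tau>, z). G k \<tau> z * \<psi> \<tau>) \<in> borel_measurable (lborel \<Otimes>\<^sub>M P)"
        unfolding G_def by measurable
      show "integrable lborel (\<lambda>\<tau>. LINT z|P. norm (case (\<tau>, z) of (\<tau>, z) \<Rightarrow> G k \<tau> z * \<psi> \<tau>))"
        using int\<psi> by (simp add: norm_mult normG)
      show "AE \<tau> in lborel. integrable P (\<lambda>z. case (\<tau>, z) of (\<tau>, z) \<Rightarrow> G k \<tau> z * \<psi> \<tau>)"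
        using intG by simp
    qed
    have "integrable lborel (\<lambda>\<tau>. LINT z|P. G k \<tau> z * \<psi> \<tau>)"
      using integrable_fst'[OF int] by simp
    then have 1: "integrable lborel (\<lambda>\<tau>. fourier_integral u k \<tau> * \<psi> \<tau>)"
      by (simp add: fi)
    have "(LINT \<tau>|lborel. fourier_integral u k \<tau> * \<psi> \<tau>) =
        (LINT \<tau>|lborel. LINT z|P. G k \<tau> z * \<psi> \<tau>)"
      by (simp add: fi)
    also have "\<dots> = (LINT z|P. LINT \<tau>|lborel. G k \<tau> z * \<psi> \<tau>)"
      using Fubini_integral[OF int] by simp
    also have "\<dots> = (LINT z|P. exp (- \<i> * of_int k * of_real (fst z)) * fourier_time \<psi> (snd z) * U z)"
    proof (intro Bochner_Integration.integral_cong refl)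
      fix z
      have "(LINT \<tau>|lborel. G k \<tau> z * \<psi> \<tau>) =
          (LINT \<tau>|lborel. (exp (- \<i> * of_int k * of_real (fst z)) * U z) *
             (exp (- \<i> * of_real (snd z) * of_real \<tau>) * \<psi> \<tau>))"
        by (simp only: G_def mult_ac)
      also have "\<dots> = (exp (- \<i> * of_int k * of_real (fst z)) * U z) * fourier_time \<psi> (snd z)"
        unfolding fourier_time_def by (rule integral_mult_right_zero)
      finally show "(LINT \<tau>|lborel. G k \<tau> z * \<psi> \<tau>) =
          exp (- \<i> * of_int k * of_real (fst z)) * fourier_time \<psi> (snd z) * U z"
        by (simp only: mult_ac)
    qed
    also have "\<dots> = (LINT (x, t) : {0..2 * pi} \<times> UNIV | lborel \<Otimes>\<^sub>M lborel.
          exp (- \<i> * of_int k * of_real x) * fourier_time \<psi> t * u x t)"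
      unfolding set_lebesgue_integral_def U_def P_def
      by (intro Bochner_Integration.integral_cong) (auto simp: case_prod_beta)
    finally show ?thesis
      using 1 by blast
  qed
  moreover have "fourier_integral u k \<in> borel_measurable lborel" for k
    unfolding fi[abs_def] using Gm sigma_finite_measure.borel_measurable_lebesgue_integral[OF sfP]
    by blast
  ultimately show ?thesis
    unfolding is_fourier_transform_def by blast
qed


section \<open>Norms and spaces\<close>

text \<open>All norms depend on a function only through its space-time Fourier transform, so they are
  defined on the Fourier side, with values in \<^typ>\<open>ennreal\<close>. In particular the norm of
  an inverse transform is the Fourier-side norm of its argument.\<close>

definition ennsqrt :: "ennreal \<Rightarrow> ennreal"
  where "ennsqrt a = (if a = \<infinity> then \<infinity> else ennreal (sqrt (enn2real a)))"

definition X_norm_hat :: "real \<Rightarrow> real \<Rightarrow> (int \<Rightarrow> real \<Rightarrow> complex) \<Rightarrow> ennreal"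
  where "X_norm_hat s b f = ennsqrt (\<integral>\<^sup>+ k. (\<integral>\<^sup>+ \<tau>.
      (ennreal (\<langle>of_int k\<rangle> powr s * \<langle>\<tau> - of_int k ^ 3\<rangle> powr b * cmod (f k \<tau>)))\<^sup>2 \<partial>lborel)
      \<partial>count_space Zdot)"

definition Y_norm_hat :: "real \<Rightarrow> (int \<Rightarrow> real \<Rightarrow> complex) \<Rightarrow> ennreal"
  where "Y_norm_hat s f = ennsqrt (\<integral>\<^sup>+ k. (\<integral>\<^sup>+ \<tau>.
      ennreal (\<langle>of_int k\<rangle> powr s * cmod (f k \<tau>)) \<partial>lborel)\<^sup>2 \<partial>count_space Zdot)"

definition W_norm_hat :: "real \<Rightarrow> (int \<Rightarrow> real \<Rightarrow> complex) \<Rightarrow> ennreal"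
  where "W_norm_hat s f = X_norm_hat s (1/2) f + Y_norm_hat s f"

definition W_norm :: "real \<Rightarrow> (real \<Rightarrow> real \<Rightarrow> complex) \<Rightarrow> ennreal"
  where "W_norm s u = W_norm_hat s (\<F> u)"

definition W_space :: "real \<Rightarrow> (real \<Rightarrow> real \<Rightarrow> complex) set"
  where "W_space s = {u.
    (\<lambda>(x, t). u x t) \<in> borel_measurable (lborel \<Otimes>\<^sub>M lborel) \<and>
    (\<forall>x t. u (x + 2 * pi) t = u x t) \<and>
    (AE t in lborel. (LINT x : {0..2 * pi} | lborel. u x t) = 0) \<and>
    tempered_in_time u \<and> (\<exists>f. is_fourier_transform u f) \<and>
    W_norm s u < \<infinity>}"


section \<open>The nonlinearity\<close>

text \<open>With the normalisation of the transform used here, the transform of a product is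
  \<open>(2\<pi>)\<^sup>-\<^sup>2\<close> times the convolution. Only nonzero frequencies occur, since the factors have zero
  mean.\<close>

abbreviation conv_measure :: "int \<Rightarrow> (int \<times> real) measure"
  where "conv_measure k \<equiv> count_space {k\<^sub>1. k\<^sub>1 \<in> Zdot \<and> k - k\<^sub>1 \<in> Zdot} \<Otimes>\<^sub>M lborel"

definition product_hat ::
    "(int \<Rightarrow> real \<Rightarrow> complex) \<Rightarrow> (int \<Rightarrow> real \<Rightarrow> complex) \<Rightarrow> int \<Rightarrow> real \<Rightarrow> complex"
  where "product_hat f g k \<tau> =
    (LINT (k\<^sub>1, \<tau>\<^sub>1) | conv_measure k. f k\<^sub>1 \<tau>\<^sub>1 * g (k - k\<^sub>1) (\<tau> - \<tau>\<^sub>1)) / of_real ((2 * pi)\<^sup>2)"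

definition product_hat_defined ::
    "(int \<Rightarrow> real \<Rightarrow> complex) \<Rightarrow> (int \<Rightarrow> real \<Rightarrow> complex) \<Rightarrow> bool"
  where "product_hat_defined f g \<longleftrightarrow>
    (\<forall>k\<in>Zdot. AE \<tau> in lborel.
       integrable (conv_measure k) (\<lambda>(k\<^sub>1, \<tau>\<^sub>1). f k\<^sub>1 \<tau>\<^sub>1 * g (k - k\<^sub>1) (\<tau> - \<tau>\<^sub>1)))"

definition dx_hat :: "(int \<Rightarrow> real \<Rightarrow> complex) \<Rightarrow> int \<Rightarrow> real \<Rightarrow> complex"
  where "dx_hat f k \<tau> = \<i> * of_int k * f k \<tau>"

definition dx_inv_hat :: "(int \<Rightarrow> real \<Rightarrow> complex) \<Rightarrow> int \<Rightarrow> real \<Rightarrow> complex"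
  where "dx_inv_hat f k \<tau> = \<i> * of_int k / (1 + (of_int k)\<^sup>2) * f k \<tau>"

text \<open>The space-time Fourier transform of \<open>F(u\<^sub>1, u\<^sub>2)\<close>.\<close>

definition F_hat ::
    "(real \<Rightarrow> real \<Rightarrow> complex) \<Rightarrow> (real \<Rightarrow> real \<Rightarrow> complex) \<Rightarrow> int \<Rightarrow> real \<Rightarrow> complex"
  where "F_hat u\<^sub>1 u\<^sub>2 k \<tau> =
    1/2 * dx_hat (product_hat (\<F> u\<^sub>1) (\<F> u\<^sub>2)) k \<tau> +
    dx_inv_hat (\<lambda>k \<tau>. product_hat (\<F> u\<^sub>1) (\<F> u\<^sub>2) k \<tau> +
                   1/2 * product_hat (dx_hat (\<F> u\<^sub>1)) (dx_hat (\<F> u\<^sub>2)) k \<tau>) k \<tau>"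

text \<open>For small \<open>s\<close> the products in \<open>F(u\<^sub>1, u\<^sub>2)\<close> are not defined for every pair in \<open>W\<^sup>s\<close>; the
  bilinear estimate is a statement about the pairs for which they are.\<close>

definition F_defined :: "(real \<Rightarrow> real \<Rightarrow> complex) \<Rightarrow> (real \<Rightarrow> real \<Rightarrow> complex) \<Rightarrow> bool"
  where "F_defined u\<^sub>1 u\<^sub>2 \<longleftrightarrow>
    product_hat_defined (\<F> u\<^sub>1) (\<F> u\<^sub>2) \<and>
    product_hat_defined (dx_hat (\<F> u\<^sub>1)) (dx_hat (\<F> u\<^sub>2))"

end

(* The failure is a high * high -> low interaction: waves at frequencies m and 1 - m produce
   an output at frequency 1 whose modulation is of order m^2. The nonlinearity contributes a
   factor m^2 there, of which the modulation weight <tau - k^3>^(1/2 - 1) takes back only m,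
   so the left-hand side is at least of order m, while the right-hand side is
   O(m^(2 max(s, 0))). Gaussian time profiles keep all transforms explicit. Since the transform
   is only specified up to null sets, its values are identified by testing against Gaussians
   times characters, which are Schwartz functions, and by Levy's uniqueness theorem. *)
theory Submission
  imports Defs
begin

section \<open>Uniqueness of the transform\<close>

text \<open>Fixing the output frequency makes its weight \<open>\<langle>1\<rangle> powr s\<close>
  independent of m, so s enters only through the two inputs. Each input is concentrated near \<tau>
  = m^3 on the cubic curve, so its modulation weight does not depend on m either, and its norm
  varies with m only through \<open>\<langle>of_int m\<rangle> powr s\<close>. The large multiplier
  comes from the product of the two derivatives: the input frequencies have opposite signs, so
  (im)(in) = -mn is positive and adds to the other terms instead of cancelling them, and the
  smoothing operator costs only a constant factor because it acts at frequency 1. The profiles have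
  a fixed width, so apart from the multiplier the output is bounded below on a unit interval of
  \<tau> whatever m is, and nothing is lost in passing to the L^2 norm. What remains is m against
  m^(2 max(s, 0)); s < 1/2 is exactly the condition that the second exponent is below 1.\<close>

definition modulated_gaussian :: "real \<Rightarrow> real \<Rightarrow> complex"
  where "modulated_gaussian \<xi> t = exp (complex_of_real (- t\<^sup>2 / 2) - \<i> * of_real \<xi> * of_real t)"

lemma norm_modulated_gaussian: "cmod (modulated_gaussian \<xi> t) = exp (- t\<^sup>2 / 2)"
  by (simp add: modulated_gaussian_def power2_eq_square)

text \<open>The quotient |t|^n / n! is one term of the series of exp |t|, and completing the square
  gives |t| - t^2/2 \<le> 1/2.\<close>

lemma abs_power_gaussian_le:
  fixes t :: real
  shows "\<bar>t\<bar> ^ n * exp (- t\<^sup>2 / 2) \<le> fact n * exp (1 / 2)"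
proof -
  have "\<bar>t\<bar> ^ n / fact n \<le> (\<Sum>i\<le>n. \<bar>t\<bar> ^ i / fact i)"
    by (rule member_le_sum) auto
  also have "\<dots> \<le> exp \<bar>t\<bar>"
    using summable_exp_generic[of "\<bar>t\<bar>"]
    by (auto simp: exp_def divide_inverse mult.commute intro!: sum_le_suminf)
  finally have "\<bar>t\<bar> ^ n \<le> fact n * exp \<bar>t\<bar>"
    by (simp add: field_simps)
  then have "\<bar>t\<bar> ^ n * exp (- t\<^sup>2 / 2) \<le> fact n * exp \<bar>t\<bar> * exp (- t\<^sup>2 / 2)"
    by (rule mult_right_mono) simp
  also have "\<dots> = fact n * exp (\<bar>t\<bar> - t\<^sup>2 / 2)"
    by (simp add: mult_exp_exp mult.assoc)
  also have "\<bar>t\<bar> - t\<^sup>2 / 2 \<le> 1 / 2"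
    using zero_le_power2[of "\<bar>t\<bar> - 1"] by (simp add: power2_eq_square algebra_simps)
  finally show ?thesis
    by simp
qed

text \<open>Polynomials times a modulated Gaussian form a class closed under differentiation and
  under multiplication by t, so this one bound covers every Schwartz seminorm.\<close>

lemma poly_modulated_gaussian_bounded:
  "bounded (range (\<lambda>t. poly p (of_real t) * modulated_gaussian \<xi> t))"
proof -
  have "cmod (poly p (of_real t) * modulated_gaussian \<xi> t)
      \<le> (\<Sum>i\<le>degree p. cmod (coeff p i) * (fact i * exp (1 / 2)))" for t
  proof -
    have "cmod (poly p (of_real t) * modulated_gaussian \<xi> t)
        = cmod (\<Sum>i\<le>degree p. coeff p i * of_real t ^ i) * exp (- t\<^sup>2 / 2)"
      by (simp only: norm_mult norm_modulated_gaussian poly_altdef)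
    also have "\<dots> \<le> (\<Sum>i\<le>degree p. cmod (coeff p i) * \<bar>t\<bar> ^ i) * exp (- t\<^sup>2 / 2)"
      by (intro mult_right_mono order.trans[OF norm_sum] sum_mono) (simp_all add: norm_mult norm_power)
    also have "\<dots> = (\<Sum>i\<le>degree p. cmod (coeff p i) * (\<bar>t\<bar> ^ i * exp (- t\<^sup>2 / 2)))"
      by (simp add: sum_distrib_right mult.assoc)
    also have "\<dots> \<le> (\<Sum>i\<le>degree p. cmod (coeff p i) * (fact i * exp (1 / 2)))"
      by (intro sum_mono mult_left_mono abs_power_gaussian_le) simp
    finally show ?thesis .
  qed
  then show ?thesis
    unfolding bounded_iff by blast
qed

text \<open>The factor \<open>[:\<i> * of_real \<xi>, 1:]\<close> is minus the logarithmic
  derivative of the modulated Gaussian. The derivative is taken in a complex variable and then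
  restricted to the real line.\<close>

lemma poly_modulated_gaussian_has_vector_derivative:
  "((\<lambda>t. poly p (of_real t) * modulated_gaussian \<xi> t) has_vector_derivative
     poly (pderiv p - [:\<i> * of_real \<xi>, 1:] * p) (of_real t) * modulated_gaussian \<xi> t) (at t)"
proof -
  have "((\<lambda>z. poly p z * exp (- z\<^sup>2 / 2 - \<i> * of_real \<xi> * z)) has_field_derivative
     poly (pderiv p - [:\<i> * of_real \<xi>, 1:] * p) (of_real t) *
       exp (- (of_real t)\<^sup>2 / 2 - \<i> * of_real \<xi> * of_real t)) (at (of_real t))"
    by (auto intro!: derivative_eq_intros simp: algebra_simps)
  from has_vector_derivative_real_field[OF this] show ?thesis
    by (simp add: modulated_gaussian_def)
qed

lemma schwartz_modulated_gaussian: "schwartz (modulated_gaussian \<xi>)"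
proof -
  let ?G = "\<lambda>p t. poly p (complex_of_real t) * modulated_gaussian \<xi> t"
  have deriv: "\<exists>p. time_deriv n (modulated_gaussian \<xi>) = ?G p" for n
  proof (induction n)
    case 0
    have "modulated_gaussian \<xi> = ?G 1"
      by simp
    then show ?case
      unfolding time_deriv_def funpow.simps id_apply by blast
  next
    case (Suc n)
    then obtain p where p: "time_deriv n (modulated_gaussian \<xi>) = ?G p"
      by blast
    have "time_deriv (Suc n) (modulated_gaussian \<xi>) =
        (\<lambda>t. vector_derivative (time_deriv n (modulated_gaussian \<xi>)) (at t))"
      by (simp add: time_deriv_def)
    also have "\<dots> = ?G (pderiv p - [:\<i> * of_real \<xi>, 1:] * p)"
      unfolding p by (intro ext vector_derivative_at poly_modulated_gaussian_has_vector_derivative)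
    finally show ?case
      by blast
  qed
  have "time_deriv n (modulated_gaussian \<xi>) differentiable at t \<and>
      bounded (range (\<lambda>t. of_real t ^ m * time_deriv n (modulated_gaussian \<xi>) t))" for m n t
  proof -
    obtain p where p: "time_deriv n (modulated_gaussian \<xi>) = ?G p"
      using deriv by blast
    have "(\<lambda>t. of_real t ^ m * ?G p t) = ?G (monom 1 m * p)"
      by (simp add: poly_monom mult.assoc)
    then have "bounded (range (\<lambda>t. of_real t ^ m * ?G p t))"
      by (simp only: poly_modulated_gaussian_bounded)
    then show ?thesis
      unfolding p using poly_modulated_gaussian_has_vector_derivative differentiableI_vector by blast
  qed
  then show ?thesis
    unfolding schwartz_def by blast
qed

text \<open>The positive and negative parts of h have the same Fourier transform. Divided by their
  common mass they become probability densities with equal characteristic functions, so Levy's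
  theorem identifies them.\<close>

lemma real_eq_0_AE_of_Fourier_eq_0:
  fixes h :: "real \<Rightarrow> real"
  assumes h: "integrable lborel h"
    and zero: "\<And>\<xi>. (LINT x|lborel. iexp (\<xi> * x) * of_real (h x)) = 0"
  shows "AE x in lborel. h x = 0"
proof -
  have [measurable]: "h \<in> borel_measurable borel"
    using h by auto
  define p q where "p x = max 0 (h x)" and "q x = max 0 (- h x)" for x
  have [measurable]: "p \<in> borel_measurable borel" "q \<in> borel_measurable borel"
    unfolding p_def q_def by measurable
  have nn: "0 \<le> p x" "0 \<le> q x" and pq: "h x = p x - q x" for x
    by (auto simp: p_def q_def)
  have ip: "integrable lborel p" and iq: "integrable lborel q"
    using h unfolding p_def q_def by (auto intro!: integrable_max)
  have intF: "integrable lborel (\<lambda>x. iexp (\<xi> * x) * complex_of_real (f x))"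
    if "integrable lborel f" for f :: "real \<Rightarrow> real" and \<xi>
  proof (rule Bochner_Integration.integrable_bound[OF that])
    have [measurable]: "f \<in> borel_measurable borel" using that by auto
    show "(\<lambda>x. iexp (\<xi> * x) * complex_of_real (f x)) \<in> borel_measurable lborel" by measurable
  qed (simp add: norm_mult)
  have eq: "(LINT x|lborel. iexp (\<xi> * x) * of_real (p x)) = (LINT x|lborel. iexp (\<xi> * x) * of_real (q x))" for \<xi>
    using zero[of \<xi>] Bochner_Integration.integral_diff[OF intF[OF ip, of \<xi>] intF[OF iq, of \<xi>]]
    by (simp add: pq right_diff_distrib)
  define c where "c = (LINT x|lborel. p x)"
  \<comment> \<open>Equality of the transforms at frequency 0 is equality of the masses.\<close>
  have cq: "c = (LINT x|lborel. q x)"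
    using eq[of 0] by (simp add: c_def)
  show ?thesis
  proof (cases "c = 0")
    \<comment> \<open>No normalisation is possible here, but nonnegative functions of integral 0
      vanish almost everywhere.\<close>
    case True
    then have "AE x in lborel. p x = 0" "AE x in lborel. q x = 0"
      using integral_nonneg_eq_0_iff_AE[OF ip] integral_nonneg_eq_0_iff_AE[OF iq] nn cq c_def by auto
    then show ?thesis
      by eventually_elim (simp add: pq)
  next
    case False
    moreover have "0 \<le> c"
      unfolding c_def using nn by simp
    ultimately have c: "0 < c"
      by simp
    define D where "D f = density lborel (\<lambda>x. ennreal (f x / c))" for f :: "real \<Rightarrow> real"
    have D: "real_distribution (D f)" "char (D f) \<xi> = (LINT x|lborel. iexp (\<xi> * x) * of_real (f x)) / of_real c"
      if f: "integrable lborel f" "\<And>x. 0 \<le> f x" "(LINT x|lborel. f x) = c" for f \<xi>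
    proof -
      have [measurable]: "f \<in> borel_measurable borel"
        using f by auto
      have "emeasure (D f) (space (D f)) = (\<integral>\<^sup>+x. ennreal (f x / c) \<partial>lborel)"
        by (simp add: D_def emeasure_density)
      also have "\<dots> = ennreal (LINT x|lborel. f x / c)"
        using f c by (intro nn_integral_eq_integral) auto
      also have "\<dots> = 1"
        using f c by simp
      finally have "prob_space (D f)"
        by (rule prob_spaceI)
      then show "real_distribution (D f)"
        by (simp add: real_distribution_def real_distribution_axioms_def D_def)
      have "char (D f) \<xi> = (LINT x|lborel. (f x / c) *\<^sub>R iexp (\<xi> * x))"
        unfolding char_def D_def using f c by (intro integral_density) auto
      also have "\<dots> = (LINT x|lborel. iexp (\<xi> * x) * of_real (f x) / of_real c)"
        by (intro Bochner_Integration.integral_cong) (auto simp: scaleR_conv_of_real)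
      finally show "char (D f) \<xi> = (LINT x|lborel. iexp (\<xi> * x) * of_real (f x)) / of_real c"
        by simp
    qed
    have "D p = D q"
      using D ip iq nn cq c_def eq by (intro Levy_uniqueness) (auto simp: fun_eq_iff)
    then have "AE x in lborel. ennreal (p x / c) = ennreal (q x / c)"
      unfolding D_def by (intro sigma_finite_measure.density_unique[OF sigma_finite_lborel]) auto
    then show ?thesis
      by eventually_elim (use c nn pq in auto)
  qed
qed

text \<open>Conjugation turns the transform at -\<xi> into that of \<open>cnj h\<close> at \<xi>, so
  it vanishes too; the real and imaginary parts are combinations of h and its conjugate.\<close>

lemma complex_eq_0_AE_of_Fourier_eq_0:
  fixes h :: "real \<Rightarrow> complex"
  assumes h: "integrable lborel h"
    and zero: "\<And>\<xi>. (LINT x|lborel. iexp (\<xi> * x) * h x) = 0"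
  shows "AE x in lborel. h x = 0"
proof -
  have [measurable]: "h \<in> borel_measurable borel"
    using h by auto
  have [measurable]: "(\<lambda>x. cnj (h x)) \<in> borel_measurable borel"
    by (rule borel_measurable_continuous_on[where f=cnj]) (simp_all add: continuous_on_cnj)
  have intF: "integrable lborel (\<lambda>x. iexp (\<xi> * x) * h x)" for \<xi>
    by (rule Bochner_Integration.integrable_bound[OF h]) (simp_all add: norm_mult)
  have intF': "integrable lborel (\<lambda>x. iexp (\<xi> * x) * cnj (h x))" for \<xi>
    by (rule Bochner_Integration.integrable_bound[OF h]) (simp_all add: norm_mult)
  have zero': "(LINT x|lborel. iexp (\<xi> * x) * cnj (h x)) = 0" for \<xi>
  proof -
    have "(LINT x|lborel. iexp (\<xi> * x) * cnj (h x)) = (LINT x|lborel. cnj (iexp (- \<xi> * x) * h x))"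
      by (intro Bochner_Integration.integral_cong) (auto simp: exp_cnj)
    also have "\<dots> = cnj (LINT x|lborel. iexp (- \<xi> * x) * h x)"
      by (rule Bochner_Integration.integral_cnj)
    finally show ?thesis
      using zero[of "- \<xi>"] by simp
  qed
  have "AE x in lborel. Re (h x) = 0"
  proof (rule real_eq_0_AE_of_Fourier_eq_0)
    fix \<xi>
    have "(LINT x|lborel. iexp (\<xi> * x) * of_real (Re (h x)))
        = (LINT x|lborel. (iexp (\<xi> * x) * h x + iexp (\<xi> * x) * cnj (h x)) / 2)"
      by (intro Bochner_Integration.integral_cong refl) (simp add: complex_add_cnj flip: distrib_left)
    then show "(LINT x|lborel. iexp (\<xi> * x) * of_real (Re (h x))) = 0"
      using Bochner_Integration.integral_add[OF intF intF', of \<xi> \<xi>] zero[of \<xi>] zero'[of \<xi>]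
      by simp
  qed (use h in auto)
  moreover have "AE x in lborel. Im (h x) = 0"
  proof (rule real_eq_0_AE_of_Fourier_eq_0)
    fix \<xi>
    have Im_eq: "complex_of_real (Im z) = (z - cnj z) / (2 * \<i>)" for z
      by (simp add: complex_diff_cnj mult.left_commute[of "\<i>"])
    have "(LINT x|lborel. iexp (\<xi> * x) * of_real (Im (h x)))
        = (LINT x|lborel. (iexp (\<xi> * x) * h x - iexp (\<xi> * x) * cnj (h x)) / (2 * \<i>))"
      by (intro Bochner_Integration.integral_cong refl)
        (simp add: Im_eq right_diff_distrib diff_divide_distrib mult_ac)
    then show "(LINT x|lborel. iexp (\<xi> * x) * of_real (Im (h x))) = 0"
      using Bochner_Integration.integral_diff[OF intF intF', of \<xi> \<xi>] zero[of \<xi>] zero'[of \<xi>]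
      by simp
  qed (use h in auto)
  ultimately show ?thesis
    by eventually_elim (simp add: complex_eq_iff)
qed

text \<open>The difference f - g need not be integrable, but its product with a Gaussian is. Testing
  against modulated Gaussians says that the Fourier transform of this product vanishes, and the
  Gaussian has no zeros to divide by.\<close>

lemma is_fourier_transform_unique:
  assumes "is_fourier_transform u f" "is_fourier_transform u g" "k \<in> Zdot"
  shows "AE \<tau> in lborel. f k \<tau> = g k \<tau>"
proof -
  let ?h = "\<lambda>\<tau>. (f k \<tau> - g k \<tau>) * modulated_gaussian 0 \<tau>"
  have mg: "modulated_gaussian (- \<xi>) \<tau> = iexp (\<xi> * \<tau>) * modulated_gaussian 0 \<tau>" for \<xi> \<tau>
    by (simp add: modulated_gaussian_def mult_exp_exp algebra_simps)
  have int: "integrable lborel (\<lambda>\<tau>. f k \<tau> * modulated_gaussian \<xi> \<tau>)"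
      "integrable lborel (\<lambda>\<tau>. g k \<tau> * modulated_gaussian \<xi> \<tau>)"
    and eq: "(LINT \<tau>|lborel. f k \<tau> * modulated_gaussian \<xi> \<tau>) =
      (LINT \<tau>|lborel. g k \<tau> * modulated_gaussian \<xi> \<tau>)" for \<xi>
    using assms schwartz_modulated_gaussian[of \<xi>] unfolding is_fourier_transform_def by auto
  have "AE \<tau> in lborel. ?h \<tau> = 0"
  proof (rule complex_eq_0_AE_of_Fourier_eq_0)
    show "integrable lborel ?h"
      using int by (simp add: left_diff_distrib)
    fix \<xi>
    have "(LINT \<tau>|lborel. iexp (\<xi> * \<tau>) * ?h \<tau>) =
        (LINT \<tau>|lborel. f k \<tau> * modulated_gaussian (- \<xi>) \<tau> - g k \<tau> * modulated_gaussian (- \<xi>) \<tau>)"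
      unfolding mg by (intro Bochner_Integration.integral_cong) (auto simp: algebra_simps)
    then show "(LINT \<tau>|lborel. iexp (\<xi> * \<tau>) * ?h \<tau>) = 0"
      using int eq by (simp add: Bochner_Integration.integral_diff)
  qed
  then show ?thesis
    by eventually_elim (simp add: modulated_gaussian_def)
qed

lemma is_fourier_transform_fourier:
  assumes "is_fourier_transform u f"
  shows "is_fourier_transform u (\<F> u)"
  unfolding fourier_def using assms by (rule someI[of "is_fourier_transform u"])

section \<open>Gaussian waves and their norms\<close>

text \<open>The profile is recentred on the cubic curve, so that after translation the weight
  \<open>\<langle>\<tau> - of_int k ^ 3\<rangle>\<close> becomes
  \<open>\<langle>\<tau>\<rangle>\<close> for every m.\<close>

definition single_mode :: "int \<Rightarrow> (real \<Rightarrow> complex) \<Rightarrow> int \<Rightarrow> real \<Rightarrow> complex"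
  where "single_mode m a k \<tau> = (if k = m then a (\<tau> - of_int m ^ 3) else 0)"

text \<open>A plane wave solution of the Airy equation u_t + u_xxx = 0, cut off in time by a
  Gaussian.\<close>

definition gaussian_wave :: "int \<Rightarrow> real \<Rightarrow> real \<Rightarrow> complex"
  where "gaussian_wave m x t = iexp (of_int m * x) * (iexp (of_int m ^ 3 * t) * of_real (std_normal_density t))"

text \<open>The factor 2 pi is the length of the period in x; the exponential is the characteristic
  function of the standard normal law.\<close>

definition gaussian_profile :: "real \<Rightarrow> complex"
  where "gaussian_profile \<tau> = of_real (2 * pi * exp (- \<tau>\<^sup>2 / 2))"

section \<open>Space-time transforms of Gaussian waves\<close>

lemma integral_lborel_times:
  fixes f g :: "real \<Rightarrow> complex"
  assumes f: "integrable lborel f" and g: "integrable lborel g"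
  shows "integrable (lborel \<Otimes>\<^sub>M lborel) (\<lambda>(x, y). f x * g y)"
    and "(LINT (x, y)|(lborel \<Otimes>\<^sub>M lborel). f x * g y) = (LINT x|lborel. f x) * (LINT y|lborel. g y)"
proof -
  have [measurable]: "f \<in> borel_measurable borel" "g \<in> borel_measurable borel"
    using f g by auto
  show *: "integrable (lborel \<Otimes>\<^sub>M lborel) (\<lambda>(x, y). f x * g y)"
  proof (rule lborel_pair.Fubini_integrable)
    show "integrable lborel (\<lambda>x. LINT y|lborel. norm (case (x, y) of (x, y) \<Rightarrow> f x * g y))"
      using f by (simp add: norm_mult)
    show "AE x in lborel. integrable lborel (\<lambda>y. case (x, y) of (x, y) \<Rightarrow> f x * g y)"
      using g by simp
  qed simp
  have "(LINT (x, y)|(lborel \<Otimes>\<^sub>M lborel). f x * g y) = (LINT x|lborel. LINT y|lborel. f x * g y)"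
    using lborel_pair.integral_fst'[OF *] by simp
  then show "(LINT (x, y)|(lborel \<Otimes>\<^sub>M lborel). f x * g y) = (LINT x|lborel. f x) * (LINT y|lborel. g y)"
    by simp
qed

lemma set_integral_period_times:
  fixes f g :: "real \<Rightarrow> complex"
  assumes f: "continuous_on {0..2 * pi} f" and g: "integrable lborel g"
  shows "set_integrable (lborel \<Otimes>\<^sub>M lborel) ({0..2 * pi} \<times> UNIV) (\<lambda>(x, t). f x * g t)"
    and "(LINT (x, t) : {0..2 * pi} \<times> UNIV|lborel \<Otimes>\<^sub>M lborel. f x * g t) =
      (LINT x : {0..2 * pi}|lborel. f x) * (LINT t|lborel. g t)"
proof -
  have i: "integrable lborel (\<lambda>x. indicat_real {0..2 * pi} x *\<^sub>R f x)"
    using borel_integrable_atLeastAtMost'[OF f] by (simp add: set_integrable_def)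
  have eq: "(\<lambda>z. indicat_real ({0..2 * pi} \<times> UNIV) z *\<^sub>R (case z of (x, t) \<Rightarrow> f x * g t)) =
      (\<lambda>(x, t). (indicat_real {0..2 * pi} x *\<^sub>R f x) * g t)"
    by (auto simp: indicator_def)
  show "set_integrable (lborel \<Otimes>\<^sub>M lborel) ({0..2 * pi} \<times> UNIV) (\<lambda>(x, t). f x * g t)"
    unfolding set_integrable_def eq by (rule integral_lborel_times(1)[OF i g])
  show "(LINT (x, t) : {0..2 * pi} \<times> UNIV|lborel \<Otimes>\<^sub>M lborel. f x * g t) =
      (LINT x : {0..2 * pi}|lborel. f x) * (LINT t|lborel. g t)"
    unfolding set_lebesgue_integral_def eq by (rule integral_lborel_times(2)[OF i g])
qed

text \<open>For j \<noteq> 0 the character has a 2 pi-periodic antiderivative, whose endpoint values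
  cancel.\<close>

lemma set_integral_period_iexp:
  "(LINT x : {0..2 * pi}|lborel. iexp (of_int j * x)) = (if j = 0 then 2 * pi else 0)"
proof (cases "j = 0")
  case True
  then show ?thesis
    by (simp add: set_lebesgue_integral_def scaleR_conv_of_real)
next
  case False
  let ?F = "\<lambda>x::real. iexp (of_int j * x) / (\<i> * of_int j)"
  have "(?F has_vector_derivative iexp (of_int j * x)) (at x within A)" for x A
  proof -
    have "((\<lambda>z. exp (\<i> * (of_int j * z)) / (\<i> * of_int j)) has_field_derivative
        exp (\<i> * (of_int j * of_real x))) (at (of_real x))"
      using False by (auto intro!: derivative_eq_intros simp: mult_ac)
    from has_vector_derivative_real_field[OF this] show ?thesis
      by (simp add: has_vector_derivative_at_within)
  qed
  then have "(LINT x|lborel. indicator {0..2 * pi} x *\<^sub>R iexp (of_int j * x)) = ?F (2 * pi) - ?F 0"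
    by (intro integral_FTC_Icc) (auto intro!: continuous_intros)
  moreover have "iexp (of_int j * (2 * pi)) = 1"
    using exp_integer_2pi[of "of_int j"] by (simp add: mult_ac)
  ultimately show ?thesis
    using False by (simp add: set_lebesgue_integral_def)
qed

lemma integral_iexp_std_normal_density:
  "(LINT t|lborel. iexp (\<xi> * t) * of_real (std_normal_density t)) = of_real (exp (- \<xi>\<^sup>2 / 2))"
proof -
  have "char std_normal_distribution \<xi> = (LINT t|lborel. std_normal_density t *\<^sub>R iexp (\<xi> * t))"
    unfolding char_def by (intro integral_density) auto
  then show ?thesis
    by (simp add: char_std_normal_distribution scaleR_conv_of_real mult.commute)
qed

lemma integrable_iexp_std_normal_density:
  "integrable lborel (\<lambda>t. iexp (\<xi> * t) * complex_of_real (std_normal_density t))"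
  by (rule Bochner_Integration.integrable_bound[OF integrable_normal_density[of 1 0]])
    (simp_all add: norm_mult)

text \<open>The integrand splits into a function of x and a function of t: orthogonality of
  characters selects k = m, and the time factor is a Gaussian characteristic function at m^3 -
  \<tau>.\<close>

lemma fourier_integral_gaussian_wave:
  "fourier_integral (gaussian_wave m) = single_mode m gaussian_profile"
proof (intro ext)
  fix k \<tau>
  have e1: "iexp (of_int (m - k) * x) = exp (- \<i> * of_int k * of_real x) * iexp (of_int m * x)" for x
    by (simp add: mult_exp_exp algebra_simps)
  have e2: "iexp ((of_int m ^ 3 - \<tau>) * t) = exp (- \<i> * of_real t * of_real \<tau>) * iexp (of_int m ^ 3 * t)" for t
    by (simp add: mult_exp_exp algebra_simps)
  have "fourier_integral (gaussian_wave m) k \<tau> =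
      (LINT (x, t) : {0..2 * pi} \<times> UNIV|lborel \<Otimes>\<^sub>M lborel. iexp (of_int (m - k) * x) *
        (iexp ((of_int m ^ 3 - \<tau>) * t) * of_real (std_normal_density t)))"
    unfolding fourier_integral_def gaussian_wave_def e1 e2 by (simp only: mult_ac)
  also have "\<dots> = complex_of_real (if m - k = 0 then 2 * pi else 0) * of_real (exp (- (of_int m ^ 3 - \<tau>)\<^sup>2 / 2))"
    by (subst set_integral_period_times(2)[OF _ integrable_iexp_std_normal_density])
      (auto intro!: continuous_intros
        simp only: integral_iexp_std_normal_density set_integral_period_iexp)
  also have "\<dots> = single_mode m gaussian_profile k \<tau>"
    by (simp add: single_mode_def gaussian_profile_def power2_commute)
  finally show "fourier_integral (gaussian_wave m) k \<tau> = single_mode m gaussian_profile k \<tau>" .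
qed

lemma is_fourier_transform_gaussian_wave:
  "is_fourier_transform (gaussian_wave m) (single_mode m gaussian_profile)"
proof -
  have "set_integrable (lborel \<Otimes>\<^sub>M lborel) ({0..2 * pi} \<times> UNIV) (\<lambda>(x, t). gaussian_wave m x t)"
    unfolding gaussian_wave_def
    by (intro set_integral_period_times(1) integrable_iexp_std_normal_density) (auto intro!: continuous_intros)
  from is_fourier_transform_fourier_integral[OF this] show ?thesis
    by (simp add: fourier_integral_gaussian_wave)
qed

lemma tempered_in_time_gaussian_wave: "tempered_in_time (gaussian_wave m)"
  unfolding tempered_in_time_def
proof (intro allI impI)
  fix \<theta>
  assume "schwartz \<theta>"
  note \<theta> = schwartz_integrable[OF this]
  then have [measurable]: "\<theta> \<in> borel_measurable borel"
    by auto
  have "integrable lborel (\<lambda>t. iexp (of_int m ^ 3 * t) * of_real (std_normal_density t) * \<theta> t)"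
  proof (rule Bochner_Integration.integrable_bound[OF \<theta>])
    have "std_normal_density t \<le> 1" for t
    proof -
      have "exp (- t\<^sup>2 / 2) \<le> sqrt (2 * pi)"
        by (rule order.trans[of _ 1]) (use pi_gt3 in auto)
      then show ?thesis
        by (simp add: std_normal_density_def)
    qed
    then show "AE t in lborel. cmod (iexp (of_int m ^ 3 * t) * of_real (std_normal_density t) * \<theta> t) \<le> cmod (\<theta> t)"
      by (intro AE_I2) (simp add: norm_mult mult_left_le_one_le)
  qed simp
  then have "set_integrable (lborel \<Otimes>\<^sub>M lborel) ({0..2 * pi} \<times> UNIV) (\<lambda>(x, t). iexp (of_int m * x) *
      (iexp (of_int m ^ 3 * t) * of_real (std_normal_density t) * \<theta> t))"
    by (intro set_integral_period_times(1)) (auto intro!: continuous_intros)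
  then show "set_integrable (lborel \<Otimes>\<^sub>M lborel) ({0..2 * pi} \<times> UNIV) (\<lambda>(x, t). gaussian_wave m x t * \<theta> t)"
    by (simp add: gaussian_wave_def mult.assoc)
qed

text \<open>All that is used later about the chosen transform \<open>\<F>\<close> of a wave. At k =
  0 only measurability is available, since the defining property does not constrain the values
  there.\<close>

lemma fourier_gaussian_wave:
  "\<F> (gaussian_wave m) k \<in> borel_measurable lborel"
  "k \<in> Zdot \<Longrightarrow> AE \<tau> in lborel. \<F> (gaussian_wave m) k \<tau> = single_mode m gaussian_profile k \<tau>"
proof -
  note F = is_fourier_transform_fourier[OF is_fourier_transform_gaussian_wave[of m]]
  show "\<F> (gaussian_wave m) k \<in> borel_measurable lborel"
    using F unfolding is_fourier_transform_def[of _ "\<F> (gaussian_wave m)"] by blast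
  show "k \<in> Zdot \<Longrightarrow> AE \<tau> in lborel. \<F> (gaussian_wave m) k \<tau> = single_mode m gaussian_profile k \<tau>"
    by (rule is_fourier_transform_unique[OF F is_fourier_transform_gaussian_wave])
qed

section \<open>W-norms of a single Fourier mode\<close>

lemma japanese_bounds: "1 \<le> \<langle>a\<rangle>" "\<langle>a\<rangle> \<le> 1 + \<bar>a\<bar>"
proof -
  show "1 \<le> \<langle>a\<rangle>" by (simp add: japanese_def)
  show "\<langle>a\<rangle> \<le> 1 + \<bar>a\<bar>" unfolding japanese_def by (rule real_le_lsqrt) (auto simp: power2_eq_square algebra_simps)
qed

lemma japanese_measurable [measurable]: "japanese \<in> borel_measurable borel"
  unfolding japanese_def by measurable

lemma ennsqrt_power2: "ennsqrt (x\<^sup>2) = x"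
  by (cases x) (auto simp: ennsqrt_def ennreal_power top_power_ennreal)

lemma ennsqrt_mono: "x \<le> y \<Longrightarrow> ennsqrt x \<le> ennsqrt y"
  by (cases x; cases y) (auto simp: ennsqrt_def top_unique)

lemma ennsqrt_power2_mult:
  assumes "0 < c"
  shows "ennsqrt ((ennreal c)\<^sup>2 * x) = ennreal c * ennsqrt x"
  using assms
  by (cases x)
    (auto simp: ennsqrt_def ennreal_power ennreal_mult_top real_sqrt_mult ennreal_mult'[symmetric])

text \<open>The part of the W-norm of a single mode that depends on neither s nor m.\<close>

definition W_profile :: "(real \<Rightarrow> complex) \<Rightarrow> ennreal"
  where "W_profile a = ennsqrt (\<integral>\<^sup>+ \<tau>. (ennreal (\<langle>\<tau>\<rangle> powr (1/2) * cmod (a \<tau>)))\<^sup>2 \<partial>lborel) +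
    (\<integral>\<^sup>+ \<tau>. ennreal (cmod (a \<tau>)) \<partial>lborel)"

text \<open>Only k = m contributes to either sum, and translating \<tau> by m^3 removes m from the
  integrals. Almost everywhere equality suffices because the norms are integrals in \<tau>.\<close>

lemma W_norm_hat_single_mode:
  assumes f: "\<And>k. k \<in> Zdot \<Longrightarrow> AE \<tau> in lborel. f k \<tau> = single_mode m a k \<tau>"
    and m: "m \<in> Zdot" and [measurable]: "a \<in> borel_measurable borel"
  shows "W_norm_hat s f = ennreal (\<langle>of_int m\<rangle> powr s) * W_profile a"
proof -
  define c where "c = \<langle>of_int m\<rangle> powr s"
  have c: "0 < c"
    using japanese_bounds(1)[of "of_int m"] by (simp add: c_def)
  let ?KX = "\<integral>\<^sup>+ \<tau>. (ennreal (\<langle>\<tau>\<rangle> powr (1/2) * cmod (a \<tau>)))\<^sup>2 \<partial>lborel"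
  let ?KY = "\<integral>\<^sup>+ \<tau>. ennreal (cmod (a \<tau>)) \<partial>lborel"
  have X: "(\<integral>\<^sup>+ \<tau>. (ennreal (\<langle>of_int k\<rangle> powr s * \<langle>\<tau> - of_int k ^ 3\<rangle> powr (1/2) * cmod (f k \<tau>)))\<^sup>2 \<partial>lborel)
      = (if k = m then (ennreal c)\<^sup>2 * ?KX else 0)" if "k \<in> Zdot" for k
  proof -
    have "(\<integral>\<^sup>+ \<tau>. (ennreal (\<langle>of_int k\<rangle> powr s * \<langle>\<tau> - of_int k ^ 3\<rangle> powr (1/2) * cmod (f k \<tau>)))\<^sup>2 \<partial>lborel)
      = (\<integral>\<^sup>+ \<tau>. (if k = m then (ennreal c)\<^sup>2 *
          (ennreal (\<langle>\<tau> - of_int m ^ 3\<rangle> powr (1/2) * cmod (a (\<tau> - of_int m ^ 3))))\<^sup>2 else 0) \<partial>lborel)"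
      using f[OF that]
      by (intro nn_integral_cong_AE, eventually_elim)
        (auto simp: single_mode_def c_def ennreal_mult' power_mult_distrib mult.assoc)
    also have "\<dots> = (if k = m then (ennreal c)\<^sup>2 * (\<integral>\<^sup>+ \<tau>.
          (ennreal (\<langle>\<tau> - of_int m ^ 3\<rangle> powr (1/2) * cmod (a (\<tau> - of_int m ^ 3))))\<^sup>2 \<partial>lborel) else 0)"
      by (simp add: nn_integral_cmult)
    also have "(\<integral>\<^sup>+ \<tau>. (ennreal (\<langle>\<tau> - of_int m ^ 3\<rangle> powr (1/2) * cmod (a (\<tau> - of_int m ^ 3))))\<^sup>2 \<partial>lborel) = ?KX"
      by (subst nn_integral_real_affine[where c=1 and t="of_int m ^ 3"]) simp_all
    finally show ?thesis .
  qed
  have Y: "(\<integral>\<^sup>+ \<tau>. ennreal (\<langle>of_int k\<rangle> powr s * cmod (f k \<tau>)) \<partial>lborel)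
      = (if k = m then ennreal c * ?KY else 0)" if "k \<in> Zdot" for k
  proof -
    have "(\<integral>\<^sup>+ \<tau>. ennreal (\<langle>of_int k\<rangle> powr s * cmod (f k \<tau>)) \<partial>lborel)
      = (\<integral>\<^sup>+ \<tau>. (if k = m then ennreal c * ennreal (cmod (a (\<tau> - of_int m ^ 3))) else 0) \<partial>lborel)"
      using f[OF that]
      by (intro nn_integral_cong_AE, eventually_elim) (auto simp: single_mode_def c_def ennreal_mult')
    also have "\<dots> = (if k = m then ennreal c * (\<integral>\<^sup>+ \<tau>. ennreal (cmod (a (\<tau> - of_int m ^ 3))) \<partial>lborel) else 0)"
      by (simp add: nn_integral_cmult)
    also have "(\<integral>\<^sup>+ \<tau>. ennreal (cmod (a (\<tau> - of_int m ^ 3))) \<partial>lborel) = ?KY"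
      by (subst nn_integral_real_affine[where c=1 and t="of_int m ^ 3"]) simp_all
    finally show ?thesis .
  qed
  have "X_norm_hat s (1/2) f = ennsqrt (\<integral>\<^sup>+ k. (if k = m then (ennreal c)\<^sup>2 * ?KX else 0) \<partial>count_space Zdot)"
    unfolding X_norm_hat_def by (intro arg_cong[where f=ennsqrt] nn_integral_cong) (simp add: X)
  also have "\<dots> = ennsqrt ((ennreal c)\<^sup>2 * ?KX)"
    using m by (subst nn_integral_count_space'[of "{m}"]) auto
  finally have "X_norm_hat s (1/2) f = ennreal c * ennsqrt ?KX"
    by (simp add: ennsqrt_power2_mult c)
  moreover have "Y_norm_hat s f = ennsqrt (\<integral>\<^sup>+ k. (if k = m then (ennreal c * ?KY)\<^sup>2 else 0) \<partial>count_space Zdot)"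
    unfolding Y_norm_hat_def by (intro arg_cong[where f=ennsqrt] nn_integral_cong) (simp add: Y)
  moreover have "\<dots> = ennsqrt ((ennreal c * ?KY)\<^sup>2)"
    using m by (subst nn_integral_count_space'[of "{m}"]) auto
  ultimately show ?thesis
    by (simp add: W_norm_hat_def W_profile_def ennsqrt_power2 distrib_left c_def)
qed

lemma gaussian_profile_measurable [measurable]: "gaussian_profile \<in> borel_measurable borel"
  unfolding gaussian_profile_def by measurable

lemma cmod_gaussian_profile: "cmod (gaussian_profile \<tau>) = 2 * pi * exp (- \<tau>\<^sup>2 / 2)"
  unfolding gaussian_profile_def norm_of_real by simp

lemma gaussian_profile_integrable: "integrable lborel gaussian_profile"
proof -
  have "integrable lborel (\<lambda>\<tau>. complex_of_real (2 * pi * (sqrt (2 * pi) * std_normal_density \<tau>)))"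
    by (intro integrable_of_real integrable_mult_right integrable_normal_density) simp
  then show ?thesis
    by (simp add: std_normal_density_def gaussian_profile_def[abs_def])
qed

text \<open>Since \<open>\<langle>\<tau>\<rangle>\<close> times the profile is bounded, the squared
  integrand of the X part is at most a constant times the integrable profile itself.\<close>

lemma W_profile_gaussian_finite: "W_profile gaussian_profile < \<infinity>"
proof -
  have Y: "(\<integral>\<^sup>+ \<tau>. ennreal (cmod (gaussian_profile \<tau>)) \<partial>lborel) < \<infinity>"
    using gaussian_profile_integrable by (simp add: integrable_iff_bounded)
  have "(ennreal (\<langle>\<tau>\<rangle> powr (1/2) * cmod (gaussian_profile \<tau>)))\<^sup>2
      \<le> ennreal (4 * pi * exp (1/2)) * ennreal (cmod (gaussian_profile \<tau>))" for \<tau>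
  proof -
    have "\<langle>\<tau>\<rangle> * exp (- \<tau>\<^sup>2 / 2) \<le> (1 + \<bar>\<tau>\<bar>) * exp (- \<tau>\<^sup>2 / 2)"
      by (intro mult_right_mono japanese_bounds) simp
    \<comment> \<open>The summands 1 and |\<tau>| are the powers n = 0 and n = 1 of
      \<open>abs_power_gaussian_le\<close>, each with constant exp (1/2).\<close>
    also have "\<dots> \<le> 2 * exp (1 / 2)"
      using add_mono[OF abs_power_gaussian_le[of \<tau> 0] abs_power_gaussian_le[of \<tau> 1]]
      by (simp only: distrib_right) simp
    finally have le: "\<langle>\<tau>\<rangle> * cmod (gaussian_profile \<tau>) \<le> 4 * pi * exp (1/2)"
      using mult_left_mono[of _ _ "2 * pi"] by (simp add: cmod_gaussian_profile mult_ac)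
    have "(\<langle>\<tau>\<rangle> powr (1/2) * cmod (gaussian_profile \<tau>))\<^sup>2 =
        \<langle>\<tau>\<rangle> * cmod (gaussian_profile \<tau>) * cmod (gaussian_profile \<tau>)"
      using japanese_bounds(1)[of \<tau>] by (simp add: powr_half_sqrt power_mult_distrib power2_eq_square)
    also have "\<dots> \<le> 4 * pi * exp (1/2) * cmod (gaussian_profile \<tau>)"
      by (intro mult_right_mono le) simp
    finally show ?thesis
      by (simp add: ennreal_power flip: ennreal_mult')
  qed
  then have "(\<integral>\<^sup>+ \<tau>. (ennreal (\<langle>\<tau>\<rangle> powr (1/2) * cmod (gaussian_profile \<tau>)))\<^sup>2 \<partial>lborel)
      \<le> (\<integral>\<^sup>+ \<tau>. ennreal (4 * pi * exp (1/2)) * ennreal (cmod (gaussian_profile \<tau>)) \<partial>lborel)"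
    by (intro nn_integral_mono)
  also have "\<dots> < \<infinity>"
    using Y by (simp add: nn_integral_cmult ennreal_mult_less_top)
  finally show ?thesis
    using Y by (simp add: W_profile_def ennsqrt_def less_top)
qed

lemma W_norm_gaussian_wave:
  "m \<in> Zdot \<Longrightarrow> W_norm s (gaussian_wave m) = ennreal (\<langle>of_int m\<rangle> powr s) * W_profile gaussian_profile"
  unfolding W_norm_def using fourier_gaussian_wave by (intro W_norm_hat_single_mode) auto

lemma gaussian_wave_in_W_space:
  assumes m: "m \<in> Zdot"
  shows "gaussian_wave m \<in> W_space s"
proof -
  have "(\<lambda>(x, t). gaussian_wave m x t) \<in> borel_measurable (lborel \<Otimes>\<^sub>M lborel)"
    unfolding gaussian_wave_def by measurable
  moreover have "gaussian_wave m (x + 2 * pi) t = gaussian_wave m x t" for x t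
    using exp_plus_2pin[of "\<i> * (of_int m * of_real x)" m]
    by (simp add: gaussian_wave_def algebra_simps)
  moreover have "(LINT x : {0..2 * pi}|lborel. gaussian_wave m x t) = 0" for t
    using m by (simp add: gaussian_wave_def set_integral_period_iexp[simplified] Zdot_def)
  moreover have "W_norm s (gaussian_wave m) < \<infinity>"
    using W_profile_gaussian_finite by (simp add: W_norm_gaussian_wave[OF m] ennreal_mult_less_top)
  ultimately show ?thesis
    using tempered_in_time_gaussian_wave is_fourier_transform_gaussian_wave
    unfolding W_space_def by blast
qed

section \<open>The nonlinearity on Gaussian waves\<close>

text \<open>The frequency sum collapses to the term m, and translating the integration variable by
  m^3 recentres the first profile. The factors are known only almost everywhere, yet the formula
  holds at every \<tau>: for fixed \<tau> the convolution integral ignores null sets.\<close>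

lemma product_hat_single_mode:
  assumes f: "\<And>k. f k \<in> borel_measurable lborel" "\<And>k. k \<in> Zdot \<Longrightarrow> AE \<tau> in lborel. f k \<tau> = single_mode m a k \<tau>"
    and g: "\<And>k. g k \<in> borel_measurable lborel" "\<And>k. k \<in> Zdot \<Longrightarrow> AE \<tau> in lborel. g k \<tau> = single_mode n b k \<tau>"
    and a: "a \<in> borel_measurable borel" and b: "b \<in> borel_measurable borel"
    and mn: "m \<in> Zdot" "n \<in> Zdot"
    and ab: "\<And>\<sigma>. integrable lborel (\<lambda>\<rho>. a \<rho> * b (\<sigma> - \<rho>))"
  shows "product_hat_defined f g"
    and "product_hat f g (m + n) \<tau> =
      (LINT \<rho>|lborel. a \<rho> * b (\<tau> - of_int m ^ 3 - of_int n ^ 3 - \<rho>)) / of_real ((2 * pi)\<^sup>2)"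
proof -
  note [measurable] = f(1) g(1) a b
  define A where "A k = {k\<^sub>1. k\<^sub>1 \<in> Zdot \<and> k - k\<^sub>1 \<in> Zdot}" for k
  define P where "P k = count_space (A k) \<Otimes>\<^sub>M (lborel :: real measure)" for k
  define h where "h k \<tau> z = f (fst z) (snd z) * g (k - fst z) (\<tau> - snd z)" for k \<tau> and z :: "int \<times> real"
  define h0 where "h0 k \<tau> z = single_mode m a (fst z) (snd z) * single_mode n b (k - fst z) (\<tau> - snd z)"
    for k \<tau> and z :: "int \<times> real"
  define I where "I \<tau> = (LINT \<rho>|lborel. a \<rho> * b (\<tau> - of_int n ^ 3 - of_int m ^ 3 - \<rho>))" for \<tau>
  have sf: "sigma_finite_measure (count_space (A k))" for k
    by (intro sigma_finite_measure_count_space_countable) simp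
  interpret pair_sigma_finite "count_space (A k)" "lborel :: real measure" for k
    by (intro pair_sigma_finite.intro sf sigma_finite_lborel)
  have sm [measurable]: "single_mode j c k \<in> borel_measurable borel" if "c \<in> borel_measurable borel" for j c k
    using that unfolding single_mode_def by measurable
  have hm: "h k \<tau> \<in> borel_measurable (P k)" for k \<tau>
    unfolding P_def h_def by (intro measurable_pair_measure_countable1) simp_all
  have h0m: "h0 k \<tau> \<in> borel_measurable (P k)" for k \<tau>
    unfolding P_def h0_def using sm a b by (intro measurable_pair_measure_countable1) simp_all
  have AE_h: "AE z in P k. h k \<tau> z = h0 k \<tau> z" for k \<tau>
    unfolding P_def
  proof (rule AE_pair_measure)
    show "{z \<in> space (count_space (A k) \<Otimes>\<^sub>M lborel). h k \<tau> z = h0 k \<tau> z} \<in> sets (count_space (A k) \<Otimes>\<^sub>M lborel)"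
      using hm[of k \<tau>] h0m[of k \<tau>] unfolding P_def by measurable
    have "AE \<rho> in lborel. h k \<tau> (k\<^sub>1, \<rho>) = h0 k \<tau> (k\<^sub>1, \<rho>)" if "k\<^sub>1 \<in> A k" for k\<^sub>1
    proof -
      have "AE \<rho> in lborel. f k\<^sub>1 \<rho> = single_mode m a k\<^sub>1 \<rho>"
        using f that by (auto simp: A_def)
      moreover have "AE \<rho> in lborel. g (k - k\<^sub>1) (\<tau> - \<rho>) = single_mode n b (k - k\<^sub>1) (\<tau> - \<rho>)"
      proof -
        have "AE \<rho> in lborel. g (k - k\<^sub>1) \<rho> = single_mode n b (k - k\<^sub>1) \<rho>"
          using g that by (auto simp: A_def)
        \<comment> \<open>The reflection \<rho> to \<tau> - \<rho> preserves null sets.\<close>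
        then have "AE \<rho> in lborel. g (k - k\<^sub>1) (\<tau> + (- 1) * \<rho>) = single_mode n b (k - k\<^sub>1) (\<tau> + (- 1) * \<rho>)"
          using sm b g(1) by (intro AE_borel_affine) auto
        then show ?thesis
          by simp
      qed
      ultimately show ?thesis
        by eventually_elim (simp add: h_def h0_def)
    qed
    then show "AE k\<^sub>1 in count_space (A k). AE \<rho> in lborel. h k \<tau> (k\<^sub>1, \<rho>) = h0 k \<tau> (k\<^sub>1, \<rho>)"
      by (simp add: AE_count_space)
  qed
  have ab': "integrable lborel (\<lambda>\<rho>. a (\<rho> - s) * b (\<sigma> - \<rho>))"
    "(LINT \<rho>|lborel. a (\<rho> - s) * b (\<sigma> - \<rho>)) = (LINT \<rho>|lborel. a \<rho> * b (\<sigma> - s - \<rho>))" for s \<sigma>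
  proof -
    show "integrable lborel (\<lambda>\<rho>. a (\<rho> - s) * b (\<sigma> - \<rho>))"
      using lborel_integrable_real_affine[OF ab[of "\<sigma> - s"], of 1 "- s"] by simp
    show "(LINT \<rho>|lborel. a (\<rho> - s) * b (\<sigma> - \<rho>)) = (LINT \<rho>|lborel. a \<rho> * b (\<sigma> - s - \<rho>))"
      by (subst lborel_integral_real_affine[where c=1 and t=s]) (simp_all add: algebra_simps)
  qed
  have h0_eq: "h0 k \<tau> (k\<^sub>1, \<rho>) = (if k\<^sub>1 = m \<and> k = m + n
      then a (\<rho> - of_int m ^ 3) * b (\<tau> - of_int n ^ 3 - \<rho>) else 0)" for k \<tau> k\<^sub>1 \<rho>
    by (auto simp: h0_def single_mode_def algebra_simps)
  have slice: "integrable lborel (\<lambda>\<rho>. h0 k \<tau> (k\<^sub>1, \<rho>))"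
    "(LINT \<rho>|lborel. h0 k \<tau> (k\<^sub>1, \<rho>)) = (if k\<^sub>1 = m \<and> k = m + n then I \<tau> else 0)" for k \<tau> k\<^sub>1
    unfolding h0_eq I_def using ab'[of "of_int m ^ 3" "\<tau> - of_int n ^ 3"]
    by (cases "k\<^sub>1 = m"; cases "k = m + n"; simp)+
  have int0: "integrable (P k) (h0 k \<tau>)" for k \<tau>
    unfolding P_def
  proof (rule Fubini_integrable)
    show "h0 k \<tau> \<in> borel_measurable (count_space (A k) \<Otimes>\<^sub>M lborel)"
      using h0m unfolding P_def .
    show "AE k\<^sub>1 in count_space (A k). integrable lborel (\<lambda>\<rho>. h0 k \<tau> (k\<^sub>1, \<rho>))"
      using slice by simp
    \<comment> \<open>At most one frequency slice is nonzero. The intersection with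
      \<open>A k\<close> is needed because m is excluded from \<open>A k\<close> when k = m.\<close>
    have "(LINT \<rho>|lborel. norm (h0 k \<tau> (k\<^sub>1, \<rho>))) = 0" if "k\<^sub>1 \<noteq> m" for k\<^sub>1
      using that by (simp add: h0_eq)
    then have "(LINT \<rho>|lborel. norm (h0 k \<tau> (k\<^sub>1, \<rho>))) = 0" if "k\<^sub>1 \<in> A k" "k\<^sub>1 \<notin> {m} \<inter> A k" for k\<^sub>1
      using that by blast
    then show "integrable (count_space (A k)) (\<lambda>k\<^sub>1. LINT \<rho>|lborel. norm (h0 k \<tau> (k\<^sub>1, \<rho>)))"
      by (intro integrableI_bounded_set[where A="{m} \<inter> A k"
            and B="LINT \<rho>|lborel. norm (h0 k \<tau> (m, \<rho>))"])
        (auto simp: AE_count_space emeasure_count_space_finite of_nat_less_top)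
  qed
  have int: "integrable (P k) (h k \<tau>)" for k \<tau>
    using int0 integrable_cong_AE[OF hm h0m AE_h] by blast
  have h_split: "(\<lambda>(k\<^sub>1, \<tau>\<^sub>1). f k\<^sub>1 \<tau>\<^sub>1 * g (k - k\<^sub>1) (\<tau> - \<tau>\<^sub>1)) = h k \<tau>" for k \<tau>
    by (auto simp: h_def)
  show "product_hat_defined f g"
    unfolding product_hat_defined_def h_split using int unfolding P_def A_def by simp
  have "(LINT z|P (m + n). h (m + n) \<tau> z) = (LINT z|P (m + n). h0 (m + n) \<tau> z)"
    by (rule integral_cong_AE[OF hm h0m AE_h])
  also have "\<dots> = (LINT k\<^sub>1|count_space (A (m + n)). LINT \<rho>|lborel. h0 (m + n) \<tau> (k\<^sub>1, \<rho>))"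
    using integral_fst'[OF int0[unfolded P_def], of "m + n" \<tau>] by (simp add: P_def)
  also have "\<dots> = (LINT k\<^sub>1|count_space (A (m + n)). (if k\<^sub>1 = m then I \<tau> else 0))"
    by (simp add: slice)
  also have "\<dots> = (\<Sum>k\<^sub>1 | k\<^sub>1 \<in> A (m + n) \<and> (if k\<^sub>1 = m then I \<tau> else 0) \<noteq> 0. if k\<^sub>1 = m then I \<tau> else 0)"
    by (rule lebesgue_integral_count_space_finite_support) (rule finite_subset[of _ "{m}"], auto)
  \<comment> \<open>That m lies in \<open>A (m + n)\<close> uses that both m and n are
    nonzero.\<close>
  also have "\<dots> = (\<Sum>k\<^sub>1\<in>{m}. if k\<^sub>1 = m then I \<tau> else 0)"
    using mn by (intro sum.mono_neutral_left) (auto simp: A_def split: if_splits)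
  finally show "product_hat f g (m + n) \<tau> =
      (LINT \<rho>|lborel. a \<rho> * b (\<tau> - of_int m ^ 3 - of_int n ^ 3 - \<rho>)) / of_real ((2 * pi)\<^sup>2)"
    unfolding product_hat_def h_split
    by (simp add: I_def P_def A_def cancel_ab_semigroup_add_class.diff_right_commute[of \<tau> "of_int n ^ 3"])
qed

section \<open>Lower bounds for the output at frequency 1\<close>

lemma gaussian_profile_convolution_integrable:
  "integrable lborel (\<lambda>\<rho>. gaussian_profile \<rho> * gaussian_profile (\<sigma> - \<rho>))"
proof (rule Bochner_Integration.integrable_bound)
  show "integrable lborel (\<lambda>\<rho>. 2 * pi * cmod (gaussian_profile \<rho>))"
    using gaussian_profile_integrable by simp
  have "cmod (gaussian_profile (\<sigma> - \<rho>)) \<le> 2 * pi" for \<rho>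
    by (simp add: cmod_gaussian_profile)
  then show "AE \<rho> in lborel. cmod (gaussian_profile \<rho> * gaussian_profile (\<sigma> - \<rho>)) \<le> norm (2 * pi * cmod (gaussian_profile \<rho>))"
    by (intro AE_I2) (simp add: norm_mult mult.commute mult_left_mono)
qed simp

text \<open>The integrand is a positive real. For \<rho> in [0, 1] both arguments have modulus at
  most 1, so the two exponents sum to at least -1, on an interval of length 1.\<close>

lemma gaussian_profile_convolution_ge:
  assumes "0 \<le> \<sigma>" "\<sigma> \<le> 1"
  shows "exp (- 1) * (2 * pi)\<^sup>2 \<le> cmod (LINT \<rho>|lborel. gaussian_profile \<rho> * gaussian_profile (\<sigma> - \<rho>))"
proof -
  let ?G = "\<lambda>\<rho>. (2 * pi * exp (- \<rho>\<^sup>2 / 2)) * (2 * pi * exp (- (\<sigma> - \<rho>)\<^sup>2 / 2))"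
  have eq: "gaussian_profile \<rho> * gaussian_profile (\<sigma> - \<rho>) = of_real (?G \<rho>)" for \<rho>
    by (simp add: gaussian_profile_def)
  have int: "integrable lborel ?G"
    using gaussian_profile_convolution_integrable[of \<sigma>] unfolding eq complex_of_real_integrable_eq .
  have "exp (- 1) * (2 * pi)\<^sup>2 = (LINT \<rho>|lborel. indicator {0..1::real} \<rho> * (exp (- 1) * (2 * pi)\<^sup>2))"
    by simp
  also have "\<dots> \<le> (LINT \<rho>|lborel. ?G \<rho>)"
  proof (rule integral_mono)
    show "integrable lborel (\<lambda>\<rho>. indicat_real {0..1::real} \<rho> * (exp (- 1) * (2 * pi)\<^sup>2))"
      by (intro integrable_mult_left integrable_real_indicator) auto
    fix \<rho>
    show "indicator {0..1} \<rho> * (exp (- 1) * (2 * pi)\<^sup>2) \<le> ?G \<rho>"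
    proof (cases "\<rho> \<in> {0..1}")
      case True
      then have "\<rho>\<^sup>2 \<le> 1" "(\<sigma> - \<rho>)\<^sup>2 \<le> 1"
        using assms by (auto simp: abs_square_le_1)
      then have "exp (- 1) \<le> exp (- \<rho>\<^sup>2 / 2 + - (\<sigma> - \<rho>)\<^sup>2 / 2)"
        by simp
      then have "exp (- 1) \<le> exp (- \<rho>\<^sup>2 / 2) * exp (- (\<sigma> - \<rho>)\<^sup>2 / 2)"
        by (simp only: exp_add)
      then have "(2 * pi)\<^sup>2 * exp (- 1) \<le> (2 * pi)\<^sup>2 * (exp (- \<rho>\<^sup>2 / 2) * exp (- (\<sigma> - \<rho>)\<^sup>2 / 2))"
        by (rule mult_left_mono) simp
      then show ?thesis
        using True by (simp add: power2_eq_square mult_ac)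
    qed simp
  qed (rule int)
  also have "\<dots> \<le> \<bar>LINT \<rho>|lborel. ?G \<rho>\<bar>"
    by simp
  also have "\<dots> = cmod (LINT \<rho>|lborel. gaussian_profile \<rho> * gaussian_profile (\<sigma> - \<rho>))"
    unfolding eq integral_complex_of_real norm_of_real ..
  finally show ?thesis .
qed

text \<open>Discarding all but one frequency and one interval of length 1 leaves the integral of a
  constant, so no further factor appears.\<close>

lemma X_norm_hat_ge:
  assumes k: "k \<in> Zdot" and L: "0 \<le> L"
    and le: "\<And>\<tau>. \<tau> \<in> {\<alpha>..\<alpha> + 1} \<Longrightarrow> L \<le> \<langle>of_int k\<rangle> powr s * \<langle>\<tau> - of_int k ^ 3\<rangle> powr b * cmod (f k \<tau>)"
  shows "ennreal L \<le> X_norm_hat s b f"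
proof -
  let ?p = "\<lambda>k. \<integral>\<^sup>+ \<tau>. (ennreal (\<langle>of_int k\<rangle> powr s * \<langle>\<tau> - of_int k ^ 3\<rangle> powr b * cmod (f k \<tau>)))\<^sup>2 \<partial>lborel"
  have "(ennreal L)\<^sup>2 = (\<integral>\<^sup>+ \<tau>. (ennreal L)\<^sup>2 * indicator {\<alpha>..\<alpha> + 1} \<tau> \<partial>lborel)"
    by (simp add: nn_integral_cmult)
  also have "\<dots> \<le> ?p k"
  proof (rule nn_integral_mono)
    fix \<tau>
    show "(ennreal L)\<^sup>2 * indicator {\<alpha>..\<alpha> + 1} \<tau> \<le>
        (ennreal (\<langle>of_int k\<rangle> powr s * \<langle>\<tau> - of_int k ^ 3\<rangle> powr b * cmod (f k \<tau>)))\<^sup>2"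
      using le[of \<tau>] L by (auto simp: indicator_def intro!: power_mono ennreal_leI)
  qed
  also have "\<dots> \<le> (\<integral>\<^sup>+ k. ?p k \<partial>count_space Zdot)"
    using k by (rule nn_integral_ge_point)
  finally show ?thesis
    unfolding X_norm_hat_def using ennsqrt_mono[of "(ennreal L)\<^sup>2"] by (simp add: ennsqrt_power2)
qed

text \<open>At k = 1 the symbols are i/2 for the first term and i/2 for the smoothing operator, and
  the product of derivatives brings -mn/2 inside the latter. In total i/2 + (i/2)(1 - mn/2) = i(1 -
  mn/4).\<close>

lemma F_gaussian_waves:
  assumes mn: "m \<in> Zdot" "n \<in> Zdot"
  shows "F_defined (gaussian_wave m) (gaussian_wave n)"
    and "m + n = 1 \<Longrightarrow> F_hat (gaussian_wave m) (gaussian_wave n) 1 \<tau> =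
      \<i> * (1 - of_int (m * n) / 4) *
      (LINT \<rho>|lborel. gaussian_profile \<rho> * gaussian_profile (\<tau> - of_int m ^ 3 - of_int n ^ 3 - \<rho>)) /
      of_real ((2 * pi)\<^sup>2)"
proof -
  let ?F = "\<lambda>m. \<F> (gaussian_wave m)"
  \<comment> \<open>A derivative in x of a single mode is again a single mode, with im absorbed into
    its profile.\<close>
  let ?a = "\<lambda>m \<tau>. \<i> * of_int m * gaussian_profile \<tau>"
  have dx: "dx_hat (?F m) k \<in> borel_measurable lborel"
    "k \<in> Zdot \<Longrightarrow> AE \<tau> in lborel. dx_hat (?F m) k \<tau> = single_mode m (?a m) k \<tau>" for m k
  proof -
    note [measurable] = fourier_gaussian_wave(1)
    show "dx_hat (?F m) k \<in> borel_measurable lborel"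
      unfolding dx_hat_def by simp
    assume "k \<in> Zdot"
    from fourier_gaussian_wave(2)[OF this, of m]
    show "AE \<tau> in lborel. dx_hat (?F m) k \<tau> = single_mode m (?a m) k \<tau>"
      by eventually_elim (simp add: dx_hat_def single_mode_def)
  qed
  have mult: "?a m \<rho> * ?a n \<sigma> = - of_int (m * n) * (gaussian_profile \<rho> * gaussian_profile \<sigma>)" for \<rho> \<sigma>
    by (simp add: algebra_simps)
  have int: "integrable lborel (\<lambda>\<rho>. ?a m \<rho> * ?a n (\<sigma> - \<rho>))" for \<sigma>
    unfolding mult using gaussian_profile_convolution_integrable by (intro integrable_mult_right)
  have meas: "?a m \<in> borel_measurable borel" for m
    by simp
  note P = product_hat_single_mode[OF fourier_gaussian_wave fourier_gaussian_wave
      gaussian_profile_measurable gaussian_profile_measurable mn gaussian_profile_convolution_integrable]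
  note D = product_hat_single_mode[OF dx dx meas meas mn int]
  show "F_defined (gaussian_wave m) (gaussian_wave n)"
    unfolding F_defined_def using P(1) D(1) by blast
  assume 1: "m + n = 1"
  define Q where "Q = (LINT \<rho>|lborel. gaussian_profile \<rho> * gaussian_profile (\<tau> - of_int m ^ 3 - of_int n ^ 3 - \<rho>))"
  have p1: "product_hat (?F m) (?F n) 1 \<tau> = Q / of_real ((2 * pi)\<^sup>2)"
    using P(2)[of \<tau>] unfolding 1 Q_def .
  have p2: "product_hat (dx_hat (?F m)) (dx_hat (?F n)) 1 \<tau> = - of_int (m * n) * Q / of_real ((2 * pi)\<^sup>2)"
    using D(2)[of \<tau>] unfolding 1 mult integral_mult_right_zero Q_def .
  show "F_hat (gaussian_wave m) (gaussian_wave n) 1 \<tau> =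
      \<i> * (1 - of_int (m * n) / 4) *
      (LINT \<rho>|lborel. gaussian_profile \<rho> * gaussian_profile (\<tau> - of_int m ^ 3 - of_int n ^ 3 - \<rho>)) /
      of_real ((2 * pi)\<^sup>2)"
    unfolding F_hat_def dx_hat_def[of "product_hat _ _"] dx_inv_hat_def Q_def[symmetric] p1 p2
    by (simp add: field_simps)
qed

text \<open>With \<open>n = 1 - m\<close> the output sits at \<open>k = 1\<close>, where the resonance
  \<open>m\<^sup>3 + n\<^sup>3 - 1 = 3m(m - 1)\<close> makes the modulation of order \<open>m\<^sup>2\<close>, while the multiplier of the
  product is \<open>1 + m(m - 1)/4\<close>.\<close>

lemma F_gaussian_waves_norm_ge:
  assumes m: "2 \<le> m"
  shows "ennreal (\<langle>1\<rangle> powr s * exp (- 1) / 16 * of_int m) \<le>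
    W_norm_hat s (\<lambda>k \<tau>. of_real (inverse \<langle>\<tau> - of_int k ^ 3\<rangle>) *
      F_hat (gaussian_wave m) (gaussian_wave (1 - m)) k \<tau>)" (is "_ \<le> W_norm_hat s ?f")
proof -
  \<comment> \<open>For \<tau> in [\<alpha>, \<alpha> + 1] the two profiles are convolved at \<tau>
    - \<alpha> in [0, 1], where the lower bound applies.\<close>
  define \<alpha> where "\<alpha> = real_of_int (m ^ 3 + (1 - m) ^ 3)"
  have \<alpha>: "\<alpha> - 1 = 3 * of_int m * (of_int m - 1)"
    by (simp add: \<alpha>_def power3_eq_cube algebra_simps)
  have mr: "2 \<le> real_of_int m"
    using m by linarith
  have "ennreal (\<langle>1\<rangle> powr s * exp (- 1) / 16 * of_int m) \<le> X_norm_hat s (1/2) ?f"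
  proof (rule X_norm_hat_ge[where k=1 and \<alpha>=\<alpha>])
    fix \<tau>
    assume \<tau>: "\<tau> \<in> {\<alpha>..\<alpha> + 1}"
    define y where "y = \<langle>\<tau> - 1\<rangle>"
    have y1: "1 \<le> y"
      unfolding y_def by (rule japanese_bounds)
    have "y \<le> 1 + \<bar>\<tau> - 1\<bar>"
      unfolding y_def by (rule japanese_bounds)
    also have "\<dots> \<le> 2 + 3 * of_int m * (of_int m - 1)"
    proof -
      have "0 \<le> 3 * real_of_int m * (of_int m - 1)"
        using mr by simp
      then show ?thesis
        using \<tau> \<alpha> by (auto simp: abs_if)
    qed
    \<comment> \<open>The difference of the two sides is m^2 + 3m - 2.\<close>
    also have "\<dots> \<le> (2 * of_int m)\<^sup>2"
      using mr by (simp add: power2_eq_square algebra_simps) (intro add_increasing, auto)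
    finally have "sqrt y \<le> 2 * of_int m"
      using mr by (intro real_le_lsqrt) auto
    then have y2: "inverse (2 * of_int m) \<le> inverse (sqrt y)"
      using y1 by (intro le_imp_inverse_le) auto
    have "exp (- 1) * (2 * pi)\<^sup>2 \<le> cmod (LINT \<rho>|lborel. gaussian_profile \<rho> *
        gaussian_profile (\<tau> - of_int m ^ 3 - of_int (1 - m) ^ 3 - \<rho>))"
      using \<tau> by (intro gaussian_profile_convolution_ge) (auto simp: \<alpha>_def)
    then have conv: "exp (- 1) \<le> cmod (LINT \<rho>|lborel. gaussian_profile \<rho> *
        gaussian_profile (\<tau> - of_int m ^ 3 - of_int (1 - m) ^ 3 - \<rho>)) / (2 * pi)\<^sup>2" (is "_ \<le> ?c")
      by (simp add: pos_le_divide_eq)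
    have "1 - of_int (m * (1 - m)) / (4 :: complex) = of_real (1 + of_int m * (of_int m - 1) / 4)"
      by (simp add: algebra_simps add_divide_distrib diff_divide_distrib)
    \<comment> \<open>After multiplication by 8 the difference of the two sides is (m - 1)^2 +
      7.\<close>
    moreover have "(of_int m)\<^sup>2 / 8 \<le> \<bar>1 + of_int m * (of_int m - 1) / (4 :: real)\<bar>"
      using mr zero_le_power2[of "real_of_int m - 1"]
      by (intro order.trans[OF _ abs_ge_self])
        (simp add: power2_eq_square algebra_simps diff_divide_distrib add_divide_distrib)
    ultimately have mult: "(of_int m)\<^sup>2 / 8 \<le> cmod (1 - of_int (m * (1 - m)) / 4)"
      by (simp only: norm_of_real)
    have "(of_int m)\<^sup>2 / 8 * exp (- 1) \<le> cmod (1 - of_int (m * (1 - m)) / 4) * ?c"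
      by (intro mult_mono mult conv) auto
    also have "\<dots> = cmod (F_hat (gaussian_wave m) (gaussian_wave (1 - m)) 1 \<tau>)"
      using m by (subst F_gaussian_waves(2)) (simp_all add: Zdot_def norm_mult norm_divide norm_power)
    finally have F: "(of_int m)\<^sup>2 / 8 * exp (- 1) \<le> cmod (F_hat (gaussian_wave m) (gaussian_wave (1 - m)) 1 \<tau>)" .
    \<comment> \<open>The constant 1/16 is 1/2 from the modulation bound times 1/8 from the
      multiplier bound.\<close>
    have "\<langle>1\<rangle> powr s * exp (- 1) / 16 * of_int m =
        \<langle>1\<rangle> powr s * (inverse (2 * of_int m) * ((of_int m)\<^sup>2 / 8 * exp (- 1)))"
      using mr by (simp add: field_simps power2_eq_square)
    also have "\<dots> \<le> \<langle>1\<rangle> powr s * (inverse (sqrt y) * cmod (F_hat (gaussian_wave m) (gaussian_wave (1 - m)) 1 \<tau>))"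
      by (intro mult_left_mono mult_mono y2 F) (use y1 in auto)
    \<comment> \<open>The power 1/2 of the X-norm weight meets the power -1 in the estimate.\<close>
    also have "inverse (sqrt y) = y powr (1/2) * inverse y"
      using y1 by (simp add: powr_half_sqrt field_simps)
    finally show "\<langle>1\<rangle> powr s * exp (- 1) / 16 * of_int m \<le>
        \<langle>of_int 1\<rangle> powr s * \<langle>\<tau> - of_int 1 ^ 3\<rangle> powr (1/2) * cmod (?f 1 \<tau>)"
      using y1 by (simp add: norm_mult norm_inverse y_def[symmetric] mult_ac)
  qed (use mr in \<open>auto simp: Zdot_def\<close>)
  also have "\<dots> \<le> W_norm_hat s ?f"
    by (simp add: W_norm_hat_def)
  finally show ?thesis .
qed

section \<open>Comparison of powers of m\<close>

theorem theorem1p1: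
  fixes s :: real
  assumes "s < 1/2"
  shows "\<not> (\<exists>C>0. \<forall>u\<^sub>1\<in>W_space s. \<forall>u\<^sub>2\<in>W_space s. F_defined u\<^sub>1 u\<^sub>2 \<longrightarrow>
           W_norm_hat s (\<lambda>k \<tau>. of_real (inverse \<langle>\<tau> - of_int k ^ 3\<rangle>) * F_hat u\<^sub>1 u\<^sub>2 k \<tau>)
             \<le> ennreal C * W_norm s u\<^sub>1 * W_norm s u\<^sub>2)"
proof
  assume "\<exists>C>0. \<forall>u\<^sub>1\<in>W_space s. \<forall>u\<^sub>2\<in>W_space s. F_defined u\<^sub>1 u\<^sub>2 \<longrightarrow>
           W_norm_hat s (\<lambda>k \<tau>. of_real (inverse \<langle>\<tau> - of_int k ^ 3\<rangle>) * F_hat u\<^sub>1 u\<^sub>2 k \<tau>)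
             \<le> ennreal C * W_norm s u\<^sub>1 * W_norm s u\<^sub>2"
  then obtain C where C: "0 < C" and bound: "\<And>u\<^sub>1 u\<^sub>2. u\<^sub>1 \<in> W_space s \<Longrightarrow> u\<^sub>2 \<in> W_space s \<Longrightarrow> F_defined u\<^sub>1 u\<^sub>2 \<Longrightarrow>
           W_norm_hat s (\<lambda>k \<tau>. of_real (inverse \<langle>\<tau> - of_int k ^ 3\<rangle>) * F_hat u\<^sub>1 u\<^sub>2 k \<tau>)
             \<le> ennreal C * W_norm s u\<^sub>1 * W_norm s u\<^sub>2"
    by blast
  obtain K where K: "0 \<le> K" "W_profile gaussian_profile = ennreal K"
    using W_profile_gaussian_finite by (cases "W_profile gaussian_profile") auto
  \<comment> \<open>For negative s the weights are simply bounded by 1, because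
    \<open>\<langle>a\<rangle>\<close> is at least 1; this keeps the exponent r in [0, 1/2).\<close>
  define r where "r = max s 0"
  define c where "c = \<langle>1\<rangle> powr s * exp (- 1) / 16"
  have c: "0 < c"
    using japanese_bounds(1)[of 1] by (simp add: c_def)
  have le: "c * x \<le> C * K\<^sup>2 * (2 * x) powr (2 * r)" if "x = of_int m" "2 \<le> m" for x and m :: int
  proof -
    have Z: "m \<in> Zdot" "1 - m \<in> Zdot"
      using that by (auto simp: Zdot_def)
    \<comment> \<open>Both |m| and |1 - m| are at most m, and \<open>\<langle>a\<rangle>\<close>
      \<le> 1 + |a|, so 2m dominates both weights.\<close>
    have jap: "\<langle>of_int j\<rangle> powr s \<le> (2 * x) powr r" if "j = m \<or> j = 1 - m" for j
    proof -
      have "\<langle>of_int j\<rangle> powr s \<le> \<langle>of_int j\<rangle> powr r"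
        using japanese_bounds(1) by (intro powr_mono) (auto simp: r_def)
      also have "\<dots> \<le> (2 * x) powr r"
        using japanese_bounds[of "of_int j"] that \<open>2 \<le> m\<close> \<open>x = of_int m\<close>
        by (intro powr_mono2) (auto simp: r_def)
      finally show ?thesis .
    qed
    have "ennreal (c * x) \<le> ennreal C * W_norm s (gaussian_wave m) * W_norm s (gaussian_wave (1 - m))"
      using order.trans[OF F_gaussian_waves_norm_ge[OF \<open>2 \<le> m\<close>, of s] bound] Z
        gaussian_wave_in_W_space F_gaussian_waves(1)
      unfolding c_def \<open>x = of_int m\<close> by blast
    also have "\<dots> = ennreal (C * (\<langle>of_int m\<rangle> powr s * K) * (\<langle>of_int (1 - m)\<rangle> powr s * K))"
      using K C Z by (simp add: W_norm_gaussian_wave ennreal_mult'' del: of_int_diff)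
    finally have "c * x \<le> C * (\<langle>of_int m\<rangle> powr s * K) * (\<langle>of_int (1 - m)\<rangle> powr s * K)"
      using K C by (subst (asm) ennreal_le_iff) auto
    also have "\<dots> \<le> C * ((2 * x) powr r * K) * ((2 * x) powr r * K)"
      using C K jap[of m] jap[of "1 - m"] by (intro mult_mono) auto
    also have "\<dots> = C * K\<^sup>2 * (2 * x) powr (2 * r)"
      by (simp add: power2_eq_square mult_ac flip: powr_add)
    finally show ?thesis .
  qed
  \<comment> \<open>The surplus power of m on the left-hand side; its positivity is where s < 1/2
    enters.\<close>
  define e where "e = 1 - 2 * r"
  have e: "0 < e"
    using assms by (simp add: e_def r_def)
  \<comment> \<open>With y = 2m, the bound c (y/2) \<le> C K^2 y^(2r) becomes y^e \<le> B; the
    factor 2 comes from m = y/2.\<close>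
  define B where "B = C * K\<^sup>2 * 2 / c"
  have "0 \<le> B"
    using C c by (simp add: B_def)
  \<comment> \<open>Chosen so that (2m)^e is at least B + 1, contradicting the bound B.\<close>
  obtain m :: int where m: "max 2 ((B + 1) powr (1 / e)) \<le> of_int m"
    using ex_of_int_less le_of_int_ceiling by blast
  then have m2: "2 \<le> m" and mB: "(B + 1) powr (1 / e) \<le> 2 * of_int m"
    by (auto intro: order.trans)
  let ?y = "2 * real_of_int m"
  have "c / 2 * ?y \<le> C * K\<^sup>2 * ?y powr (2 * r)"
    using le[OF refl m2] by simp
  moreover have "?y = ?y powr e * ?y powr (2 * r)"
    using m2 by (simp add: e_def flip: powr_add)
  ultimately have "c / 2 * ?y powr e * ?y powr (2 * r) \<le> C * K\<^sup>2 * ?y powr (2 * r)"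
    by (simp add: mult.assoc)
  then have "c / 2 * ?y powr e \<le> C * K\<^sup>2"
    using m2 by (subst (asm) mult_le_cancel_right_pos) auto
  then have "?y powr e \<le> B"
    using c by (simp add: B_def field_simps)
  moreover have "B + 1 = ((B + 1) powr (1 / e)) powr e"
    using \<open>0 \<le> B\<close> e by (simp add: powr_powr)
  moreover have "\<dots> \<le> ?y powr e"
    using mB e by (intro powr_mono2) auto
  ultimately show False
    by simp
qed

end
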